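(* Let $G$ be a nice graph. If $G$ admits an improper twin $k$-edge coloring for some integer $k\geq 2$, then $G$ admits an improper twin $t$-edge coloring for every integer $t\geq k$.
   Context: A graph is nice if it has no connected component isomorphic to $K_2$. For an integer $k\geq 2$, an improper twin $k$-edge coloring of $G$ is a map $s:E(G)\to\mathbb{Z}_k$ (adjacent edges may receive equal colors) such that $c_s(v)=\sum_{e\in E_v}s(e)$ computed in $\mathbb{Z}_k$ (with $E_v$ the set of edges incident to $v$; the empty sum is $0$) is a proper vertex coloring of $G$. *)

theory Defs
  imports "HOL-Number_Theory.Residues"
begin

text \<open>A graph is given by a vertex set \<open>V\<close> and a set \<open>E\<close> of two-element subsets of \<open>V\<close>.\<close>

definition finite_simple_graph :: "'a set \<Rightarrow> 'a set set \<Rightarrow> bool" where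
  "finite_simple_graph V E \<longleftrightarrow> finite V \<and> (\<forall>e\<in>E. e \<subseteq> V \<and> card e = 2)"

definition connected_components :: "'a set \<Rightarrow> 'a set set \<Rightarrow> 'a set set" where
  "connected_components V E = V // {(u, v) \<in> V \<times> V. (\<lambda>x y. {x, y} \<in> E)\<^sup>*\<^sup>* u v}"

definition induced_edges :: "'a set set \<Rightarrow> 'a set \<Rightarrow> 'a set set" where
  "induced_edges E C = {e \<in> E. e \<subseteq> C}"

definition graph_isomorphic :: "'a set \<Rightarrow> 'a set set \<Rightarrow> 'b set \<Rightarrow> 'b set set \<Rightarrow> bool" where
  "graph_isomorphic V E V' E' \<longleftrightarrow>
     (\<exists>f. bij_betw f V V' \<and> (\<forall>u\<in>V. \<forall>v\<in>V. {u, v} \<in> E \<longleftrightarrow> {f u, f v} \<in> E'))"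

definition complete_edges :: "'a set \<Rightarrow> 'a set set" where
  "complete_edges V = {e. e \<subseteq> V \<and> card e = 2}"

definition nice_graph :: "'a set \<Rightarrow> 'a set set \<Rightarrow> bool" where
  "nice_graph V E \<longleftrightarrow>
     \<not> (\<exists>C\<in>connected_components V E.
          graph_isomorphic C (induced_edges E C) {..<2::nat} (complete_edges {..<2::nat}))"

definition incident_edges :: "'a set set \<Rightarrow> 'a \<Rightarrow> 'a set set" where
  "incident_edges E v = {e \<in> E. v \<in> e}"

definition proper_vertex_coloring :: "'a set \<Rightarrow> 'a set set \<Rightarrow> ('a \<Rightarrow> 'c) \<Rightarrow> bool" where
  "proper_vertex_coloring V E c \<longleftrightarrow> (\<forall>u\<in>V. \<forall>v\<in>V. {u, v} \<in> E \<longrightarrow> c u \<noteq> c v)"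

definition induced_vertex_coloring :: "int \<Rightarrow> 'a set set \<Rightarrow> ('a set \<Rightarrow> int) \<Rightarrow> 'a \<Rightarrow> int" where
  "induced_vertex_coloring k E s v = finsum (residue_ring k) s (incident_edges E v)"

definition improper_twin_edge_coloring ::
  "int \<Rightarrow> 'a set \<Rightarrow> 'a set set \<Rightarrow> ('a set \<Rightarrow> int) \<Rightarrow> bool" where
  "improper_twin_edge_coloring k V E s \<longleftrightarrow>
     s \<in> E \<rightarrow> carrier (residue_ring k) \<and>
     proper_vertex_coloring V E (induced_vertex_coloring k E s)"

definition admits_improper_twin_edge_coloring :: "int \<Rightarrow> 'a set \<Rightarrow> 'a set set \<Rightarrow> bool" where
  "admits_improper_twin_edge_coloring k V E \<longleftrightarrow> (\<exists>s. improper_twin_edge_coloring k V E s)"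

end

theory Submission
  imports Defs
begin

text \<open>
  Call an integer function on the vertices realizable modulo \<open>t\<close> if it is the vertex-sum function
  of an edge weighting modulo \<open>t\<close>. The realizable functions form a group containing \<open>e\<^sub>u + e\<^sub>v\<close> for
  every edge \<open>uv\<close>, where \<open>e\<^sub>v\<close> is the indicator of \<open>v\<close>. Fix a vertex \<open>r\<close>; along walks one sees
  that for each \<open>v\<close> in its component \<open>C\<close> some \<open>e\<^sub>v - g v \<cdot> e\<^sub>r\<close> with \<open>g v = \<plusminus>1\<close> is realizable.

  If \<open>2 e\<^sub>r\<close> is realizable, then so is every function on \<open>C\<close> with even sum, and every function at all
  if \<open>t\<close> is odd. The given colouring uses only the residues below \<open>k < t\<close>; if \<open>t\<close> is even and the
  sum is odd, recolouring one vertex with the unused odd residue \<open>t - 1\<close>, or with \<open>0\<close> if all colours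
  are odd, repairs the parity.

  If \<open>2 e\<^sub>r\<close> is not realizable, then \<open>g\<close> is a proper 2-colouring of \<open>C\<close>. As \<open>G\<close> is nice, either \<open>C\<close>
  is a single vertex or one of the classes of \<open>g\<close> has at least two vertices. A function vanishing on
  the other class, nonzero modulo \<open>t \<ge> 3\<close> on this one and with sum \<open>0\<close> is proper and realizable.
\<close>

section \<open>Functions arising as vertex sums of edge weights modulo \<open>t\<close>\<close>

definition unit_at :: "'a \<Rightarrow> 'a \<Rightarrow> int" where
  "unit_at x v = of_bool (v = x)"

text \<open>Weights are arbitrary integers and vertex sums are compared only up to congruence, so
  closure under linear combinations is immediate. Reduction to residues is postponed to the
  end.\<close>

definition realizable :: "int \<Rightarrow> 'a set \<Rightarrow> 'a set set \<Rightarrow> ('a \<Rightarrow> int) \<Rightarrow> bool" where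
  "realizable t V E f \<longleftrightarrow> (\<exists>s. \<forall>v\<in>V. [f v = (\<Sum>e\<in>incident_edges E v. s e)] (mod t))"

lemma realizable_cong:
  assumes "realizable t V E f" "\<And>v. v \<in> V \<Longrightarrow> [g v = f v] (mod t)"
  shows "realizable t V E g"
  using assms unfolding realizable_def by (meson cong_trans)

lemma realizable_zero: "realizable t V E (\<lambda>v. 0)"
  unfolding realizable_def by (rule exI[of _ "\<lambda>e. 0"]) simp

lemma realizable_add:
  assumes "realizable t V E f" "realizable t V E g"
  shows "realizable t V E (\<lambda>v. f v + g v)"
proof -
  obtain a b where "\<forall>v\<in>V. [f v = (\<Sum>e\<in>incident_edges E v. a e)] (mod t)"
    and "\<forall>v\<in>V. [g v = (\<Sum>e\<in>incident_edges E v. b e)] (mod t)"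
    using assms unfolding realizable_def by blast
  then show ?thesis
    unfolding realizable_def by (intro exI[of _ "\<lambda>e. a e + b e"]) (auto simp: sum.distrib intro: cong_add)
qed

lemma realizable_scale:
  assumes "realizable t V E f"
  shows "realizable t V E (\<lambda>v. m * f v)"
proof -
  obtain a where "\<forall>v\<in>V. [f v = (\<Sum>e\<in>incident_edges E v. a e)] (mod t)"
    using assms unfolding realizable_def by blast
  then show ?thesis
    unfolding realizable_def
    by (intro exI[of _ "\<lambda>e. m * a e"]) (auto simp: sum_distrib_left[symmetric] intro: cong_scalar_left)
qed

lemma realizable_diff:
  assumes "realizable t V E f" "realizable t V E g"
  shows "realizable t V E (\<lambda>v. f v - g v)"
  using realizable_add[OF assms(1) realizable_scale[OF assms(2), of "-1"]] by simp

lemma realizable_sum: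
  assumes "finite I" "\<And>i. i \<in> I \<Longrightarrow> realizable t V E (f i)"
  shows "realizable t V E (\<lambda>v. \<Sum>i\<in>I. f i v)"
  using assms by (induction I rule: finite_induct) (auto intro: realizable_zero realizable_add)

lemma finite_edges:
  assumes "finite_simple_graph V E"
  shows "finite E"
proof (rule finite_subset)
  show "E \<subseteq> Pow V" "finite (Pow V)"
    using assms unfolding finite_simple_graph_def by auto
qed

lemma edgeD:
  assumes "finite_simple_graph V E" "{u, v} \<in> E"
  shows "u \<in> V" "v \<in> V" "u \<noteq> v"
  using assms unfolding finite_simple_graph_def by fastforce+

lemma realizable_edge:
  assumes "finite_simple_graph V E" "{u, w} \<in> E"
  shows "realizable t V E (\<lambda>v. unit_at u v + unit_at w v)"
proof -
  have "u \<noteq> w" using edgeD[OF assms] by simp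
  have "(\<Sum>e\<in>incident_edges E v. of_bool (e = {u, w})) = unit_at u v + unit_at w v" for v
  proof -
    have "(\<Sum>e\<in>incident_edges E v. of_bool (e = {u, w})) = (of_bool ({u, w} \<in> incident_edges E v) :: int)"
      using finite_edges[OF assms(1)] by (simp add: incident_edges_def of_bool_def)
    also have "\<dots> = unit_at u v + unit_at w v"
      using assms(2) \<open>u \<noteq> w\<close> by (auto simp: incident_edges_def unit_at_def)
    finally show ?thesis .
  qed
  then show ?thesis
    unfolding realizable_def by (intro exI[of _ "\<lambda>e. of_bool (e = {u, w})"]) simp
qed

text \<open>Induction along a walk: subtracting the function found for \<open>y\<close> from the
  edge function of \<open>{y, z}\<close> leaves the one for \<open>z\<close>, with the sign flipped.
  Hence the sign records the parity of the walk.\<close>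

lemma realizable_reachable:
  assumes "finite_simple_graph V E" "(\<lambda>x y. {x, y} \<in> E)\<^sup>*\<^sup>* r v"
  shows "\<exists>g\<in>{1, -1}. realizable t V E (\<lambda>x. unit_at v x - g * unit_at r x)"
  using assms(2)
proof (induction rule: rtranclp_induct)
  case base
  have "realizable t V E (\<lambda>x. unit_at r x - 1 * unit_at r x)"
    using realizable_zero by simp
  then show ?case by blast
next
  case (step y z)
  then obtain g :: int where g: "g \<in> {1, -1}"
    and "realizable t V E (\<lambda>x. unit_at y x - g * unit_at r x)" by blast
  from realizable_diff[OF realizable_edge[OF assms(1) step(2)] this(2)]
  have "realizable t V E (\<lambda>x. unit_at z x - (- g) * unit_at r x)"
    by (rule realizable_cong) simp
  moreover have "- g \<in> {1, -1}" using g by auto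
  ultimately show ?case by blast
qed

text \<open>Modulo realizable functions each \<open>unit_at v\<close> may be replaced by
  \<open>g v\<close> times \<open>unit_at r\<close>. This moves all of \<open>f\<close> to the root,
  where a single coefficient remains to be realized.\<close>

lemma realizable_expand:
  assumes "finite C" "\<And>v. v \<notin> C \<Longrightarrow> f v = 0"
    and g: "\<And>v. v \<in> C \<Longrightarrow> realizable t V E (\<lambda>x. unit_at v x - g v * unit_at r x)"
    and r: "realizable t V E (\<lambda>x. (\<Sum>v\<in>C. f v * g v) * unit_at r x)"
  shows "realizable t V E f"
proof -
  have *: "f x = (\<Sum>v\<in>C. f v * (unit_at v x - g v * unit_at r x)) + (\<Sum>v\<in>C. f v * g v) * unit_at r x" for x
  proof -
    have "(\<Sum>v\<in>C. f v * unit_at v x) = (\<Sum>v\<in>C. if v = x then f v else 0)"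
      by (rule sum.cong) (auto simp: unit_at_def)
    also have "\<dots> = f x"
      using assms(1,2) by simp
    finally show ?thesis
      by (simp add: right_diff_distrib sum_subtractf sum_distrib_right mult.assoc)
  qed
  have "realizable t V E (\<lambda>x. (\<Sum>v\<in>C. f v * (unit_at v x - g v * unit_at r x)) + (\<Sum>v\<in>C. f v * g v) * unit_at r x)"
    by (rule realizable_add[OF realizable_sum[OF assms(1) realizable_scale[OF g]] r])
  then show ?thesis
    by (rule realizable_cong) (simp only: *[symmetric] cong_refl)
qed

lemma nonzero_values_sum_zero:
  fixes t :: int
  assumes "t \<ge> 3" "finite A" "card A \<ge> 2"
  shows "\<exists>f. (\<forall>v\<in>A. \<not> t dvd f v) \<and> (\<Sum>v\<in>A. f v) = (0::int)"
proof -
  obtain a b B where A: "A = insert a (insert b B)" "a \<noteq> b" "a \<notin> B" "b \<notin> B"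
    using assms(3) by (metis card_le_Suc_iff numeral_2_eq_2 insert_iff)
  have "finite B" using assms(2) A by simp
  let ?m = "int (card B)"
  have small: "\<not> t dvd 1" "\<not> t dvd 2" "\<not> t dvd -1"
    using assms(1) by (auto dest: zdvd_imp_le)
  \<comment> \<open>All but two elements get the value 1, the last two get \<open>x\<close> and
    \<open>- ?m - x\<close>. As \<open>t\<close> cannot divide both \<open>?m + 1\<close> and
    \<open>?m + 2\<close>, one of the choices 1, 2 for \<open>x\<close> keeps the last value nonzero
    modulo \<open>t\<close>.\<close>
  define x where "x = (if t dvd ?m + 1 then 2 else 1 :: int)"
  have x: "\<not> t dvd x" "\<not> t dvd (- ?m - x)"
  proof -
    show "\<not> t dvd x" using small by (simp add: x_def)
    show "\<not> t dvd (- ?m - x)"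
    proof
      assume d: "t dvd (- ?m - x)"
      then have *: "t dvd ?m + x" by (metis add.commute diff_minus_eq_add dvd_minus_iff minus_diff_eq uminus_add_conv_diff)
      show False
      proof (cases "t dvd ?m + 1")
        case True
        with * have "t dvd (?m + 2) - (?m + 1)" by (intro dvd_diff) (simp_all add: x_def)
        then show False using small by simp
      qed (use * in \<open>simp add: x_def\<close>)
    qed
  qed
  define f where "f = (\<lambda>v. if v = a then x else if v = b then - ?m - x else 1)"
  have "(\<Sum>v\<in>B. f v) = (\<Sum>v\<in>B. 1)"
    by (rule sum.cong) (use A in \<open>auto simp: f_def\<close>)
  then have "(\<Sum>v\<in>A. f v) = 0"
    using A \<open>finite B\<close> by (simp add: f_def)
  moreover have "\<forall>v\<in>A. \<not> t dvd f v"
    using x small by (auto simp: f_def)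
  ultimately show ?thesis by blast
qed

section \<open>From integer sums to sums in the residue ring\<close>

lemma finsum_residue_ring:
  assumes "m \<ge> 2" "finite A" "s \<in> A \<rightarrow> carrier (residue_ring m)"
  shows "finsum (residue_ring m) s A = (\<Sum>a\<in>A. s a) mod m"
proof -
  interpret residues m "residue_ring m" using assms(1) by unfold_locales auto
  show ?thesis
    using assms(2,3)
  proof (induction A rule: finite_induct)
    case empty
    then show ?case by (simp add: res_zero_eq)
  next
    case (insert a A)
    then have "finsum (residue_ring m) s (insert a A) = (s a + (\<Sum>a\<in>A. s a) mod m) mod m"
      by (subst finsum_insert) (auto simp: res_add_eq)
    with insert(1,2) show ?case by (simp add: mod_add_right_eq)
  qed
qed

lemma admits_improper_twin_edge_coloringI:
  assumes "finite_simple_graph V E" "t \<ge> 2" "realizable t V E f"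
    and proper: "\<And>u v. {u, v} \<in> E \<Longrightarrow> \<not> [f u = f v] (mod t)"
  shows "admits_improper_twin_edge_coloring t V E"
proof -
  obtain s where s: "\<forall>v\<in>V. [f v = (\<Sum>e\<in>incident_edges E v. s e)] (mod t)"
    using assms(3) unfolding realizable_def by blast
  interpret residues t "residue_ring t" using assms(2) by unfold_locales auto
  let ?s = "\<lambda>e. s e mod t"
  have carrier: "?s \<in> A \<rightarrow> carrier (residue_ring t)" for A
    by auto
  have *: "induced_vertex_coloring t E ?s v = f v mod t" if "v \<in> V" for v
  proof -
    have "finite (incident_edges E v)"
      using finite_edges[OF assms(1)] by (simp add: incident_edges_def)
    from finsum_residue_ring[OF assms(2) this carrier] s that show ?thesis
      by (simp add: induced_vertex_coloring_def mod_sum_eq cong_def)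
  qed
  have "proper_vertex_coloring V E (induced_vertex_coloring t E ?s)"
    using proper by (auto simp: proper_vertex_coloring_def * cong_def)
  with carrier show ?thesis
    unfolding admits_improper_twin_edge_coloring_def improper_twin_edge_coloring_def
    by (intro exI[of _ ?s] conjI)
qed

lemma improper_twin_edge_coloring_range:
  assumes "improper_twin_edge_coloring k V E s" "k \<ge> 2"
  shows "induced_vertex_coloring k E s v \<in> {0..k-1}"
proof -
  interpret residues k "residue_ring k" using assms(2) by unfold_locales auto
  have "s \<in> incident_edges E v \<rightarrow> carrier (residue_ring k)"
    using assms(1) by (auto simp: improper_twin_edge_coloring_def incident_edges_def)
  then have "finsum (residue_ring k) s (incident_edges E v) \<in> carrier (residue_ring k)"
    by (rule finsum_closed)
  then show ?thesis
    by (simp add: induced_vertex_coloring_def res_carrier_eq)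
qed

section \<open>Construction on one connected component\<close>

lemma equiv_reachable:
  assumes "finite_simple_graph V E"
  shows "equiv V {(u, v) \<in> V \<times> V. (\<lambda>x y. {x, y} \<in> E)\<^sup>*\<^sup>* u v}"
proof (rule equivI)
  have "symp (\<lambda>x y. {x, y} \<in> E)\<^sup>*\<^sup>*"
    by (intro symp_rtranclp sympI) (simp add: insert_commute)
  then show "sym {(u, v) \<in> V \<times> V. (\<lambda>x y. {x, y} \<in> E)\<^sup>*\<^sup>* u v}"
    by (auto intro!: symI dest: sympD)
  show "trans {(u, v) \<in> V \<times> V. (\<lambda>x y. {x, y} \<in> E)\<^sup>*\<^sup>* u v}"
    by (auto intro!: transI)
qed (auto intro!: refl_onI)

lemma graph_isomorphic_K2:
  assumes "finite_simple_graph V E" "{a, b} \<in> E"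
  shows "graph_isomorphic {a, b} (induced_edges E {a, b}) {..<2::nat} (complete_edges {..<2::nat})"
  unfolding graph_isomorphic_def
proof (intro exI conjI)
  have "a \<noteq> b" using edgeD[OF assms] by simp
  let ?f = "\<lambda>x. if x = a then 0 else 1 :: nat"
  show "bij_betw ?f {a, b} {..<2::nat}"
    using \<open>a \<noteq> b\<close> by (auto simp: bij_betw_def inj_on_def lessThan_nat_numeral)
  \<comment> \<open>This settles the pairs with \<open>u = v\<close>, where \<open>{u, v}\<close>
    collapses to a singleton.\<close>
  have "{x} \<notin> E" for x
    using assms(1) unfolding finite_simple_graph_def by force
  then show "\<forall>u\<in>{a, b}. \<forall>v\<in>{a, b}. {u, v} \<in> induced_edges E {a, b} \<longleftrightarrow> {?f u, ?f v} \<in> complete_edges {..<2::nat}"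
    using \<open>a \<noteq> b\<close> assms(2) by (auto simp: induced_edges_def complete_edges_def insert_commute)
qed

text \<open>The function is made to vanish off \<open>C\<close> so that the functions of different
  components can be added without disturbing each other. The given colouring enters only through
  properness and the range of its colours.\<close>

lemma component_proper_realizable:
  assumes G: "finite_simple_graph V E" and nice: "nice_graph V E"
    and "k \<ge> 2" "t > k"
    and c: "proper_vertex_coloring V E c" "\<And>v. c v \<in> {0..k-1}"
    and C: "C \<in> connected_components V E"
  shows "\<exists>f. (\<forall>u\<in>C. \<forall>v\<in>C. {u, v} \<in> E \<longrightarrow> \<not> [f u = f v] (mod t)) \<and>
             (\<forall>v. v \<notin> C \<longrightarrow> f v = 0) \<and> realizable t V E f"
proof -
  let ?adj = "\<lambda>x y. {x, y} \<in> E"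
  obtain r where r: "r \<in> V" "C = {v \<in> V. ?adj\<^sup>*\<^sup>* r v}"
    using C unfolding connected_components_def by (auto elim!: quotientE)
  then have "r \<in> C" by simp
  have "C \<subseteq> V" using r by blast
  have "finite C" using r G unfolding finite_simple_graph_def by simp
  have "\<forall>v\<in>C. \<exists>g\<in>{1, -1}. realizable t V E (\<lambda>x. unit_at v x - g * unit_at r x)"
    using r realizable_reachable[OF G] by blast
  then obtain g :: "'a \<Rightarrow> int" where g: "\<And>v. v \<in> C \<Longrightarrow> g v \<in> {1, -1}"
    and gR: "\<And>v. v \<in> C \<Longrightarrow> realizable t V E (\<lambda>x. unit_at v x - g v * unit_at r x)"
    by metis
  show ?thesis
  proof (cases "realizable t V E (\<lambda>x. 2 * unit_at r x)")
    case True
    have even_real: "realizable t V E (\<lambda>x. m * unit_at r x)" if "even m" for m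
    proof -
      from that obtain n where "m = n * 2" by (metis dvdE mult.commute)
      with realizable_scale[OF True, of n] show ?thesis by (simp add: mult.assoc)
    qed
    have real: "realizable t V E f"
      if "\<And>v. v \<notin> C \<Longrightarrow> f v = 0" "odd t \<or> even (\<Sum>v\<in>C. f v)" for f
    proof (rule realizable_expand[OF \<open>finite C\<close> that(1) gR])
      let ?m = "\<Sum>v\<in>C. f v * g v"
      show "realizable t V E (\<lambda>x. ?m * unit_at r x)"
      proof (cases "even ?m")
        case False
        \<comment> \<open>Each \<open>g v - 1\<close> is 0 or -2, so the root coefficient
          \<open>?m\<close> has the parity of the sum of \<open>f\<close>. If it is odd, then
          \<open>t\<close> is odd, and adding \<open>t\<close> makes it even without changing its
          residue.\<close>
        have "?m = (\<Sum>v\<in>C. f v) + (\<Sum>v\<in>C. f v * (g v - 1))"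
          by (simp add: right_diff_distrib sum_subtractf)
        moreover have "even (\<Sum>v\<in>C. f v * (g v - 1))"
          using g by (intro dvd_sum) fastforce
        ultimately have "odd t" using False that(2) by auto
        then have "realizable t V E (\<lambda>x. (?m + t) * unit_at r x)"
          using False by (intro even_real) simp
        then show ?thesis
          by (rule realizable_cong) (simp add: cong_iff_dvd_diff left_diff_distrib[symmetric])
      qed (rule even_real)
    qed
    have neq: "\<not> [x = y] (mod t)" if "x \<noteq> y" "x \<in> {0..t-1}" "y \<in> {0..t-1}" for x y :: int
      using that by (simp add: cong_def)
    have cr: "c v \<in> {0..t-1}" "c v \<noteq> t - 1" for v
      using c(2)[of v] \<open>t > k\<close> by auto
    let ?c = "\<lambda>v. if v \<in> C then c v else 0"
    have cn: "c u \<noteq> c v" if "{u, v} \<in> E" for u v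
      using c(1) edgeD[OF G that] that unfolding proper_vertex_coloring_def by blast
    show ?thesis
    proof (cases "odd t \<or> even (\<Sum>v\<in>C. c v)")
      case True
      then have "realizable t V E ?c"
        by (intro real) auto
      then show ?thesis
        by (intro exI[of _ ?c]) (use cn cr neq in auto)
    next
      case odd_sum: False
      obtain w z where w: "w \<in> C" "z \<in> {0..t-1}" "\<And>v. v \<in> C \<Longrightarrow> c v \<noteq> z" "odd (z - c w)"
      proof (cases "\<exists>w\<in>C. even (c w)")
        case True
        then obtain w where "w \<in> C" "even (c w)" by blast
        then show ?thesis
          \<comment> \<open>Here \<open>t\<close> is even, so \<open>t - 1\<close> is odd, and it
            exceeds every colour because these are at most \<open>k - 1\<close>.\<close>
          using that[of w "t - 1"] odd_sum cr \<open>t > k\<close> \<open>k \<ge> 2\<close> by auto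
      next
        case False
        show ?thesis
        proof (rule that[of r 0])
          show "c v \<noteq> 0" if "v \<in> C" for v using that False by auto
        qed (use False \<open>r \<in> C\<close> \<open>t > k\<close> \<open>k \<ge> 2\<close> in auto)
      qed
      let ?f = "?c(w := z)"
      have "(\<Sum>v\<in>C. ?f v) = z + (\<Sum>v\<in>C - {w}. ?f v)"
        using \<open>finite C\<close> w(1) by (simp add: sum.remove)
      also have "(\<Sum>v\<in>C - {w}. ?f v) = (\<Sum>v\<in>C - {w}. c v)"
        by (rule sum.cong) auto
      also have "z + \<dots> = (z - c w) + (\<Sum>v\<in>C. c v)"
        using \<open>finite C\<close> w(1) by (simp add: sum.remove)
      finally have "even (\<Sum>v\<in>C. ?f v)"
        using odd_sum w(4) by (metis odd_add)
      then have "realizable t V E ?f"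
        using w(1) by (intro real) auto
      moreover have "\<not> [?f u = ?f v] (mod t)" if "u \<in> C" "v \<in> C" "{u, v} \<in> E" for u v
      proof (rule neq)
        show "?f u \<noteq> ?f v"
          using that edgeD[OF G that(3)] cn[OF that(3)] w(3)[OF that(1)] w(3)[OF that(2)] by auto
      qed (use that w(2) cr in auto)
      ultimately show ?thesis
        by (intro exI[of _ ?f]) (use w(1) in auto)
    qed
  next
    case not_real: False
    have bip: "g u \<noteq> g v" if "u \<in> C" "v \<in> C" "{u, v} \<in> E" for u v
    proof
      assume "g u = g v"
      \<comment> \<open>The bracket equals \<open>(g u + g v) * unit_at r x\<close>. With equal
        signs the factor \<open>g u\<close> turns this into \<open>2 * unit_at r x\<close>, since
        \<open>g u * g u = 1\<close>.\<close>
      have "realizable t V E (\<lambda>x. g u * ((unit_at u x + unit_at v x)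
              - (unit_at u x - g u * unit_at r x) - (unit_at v x - g v * unit_at r x)))"
        using that by (intro realizable_scale realizable_diff realizable_edge[OF G] gR)
      then have "realizable t V E (\<lambda>x. 2 * unit_at r x)"
        by (rule realizable_cong) (use \<open>g u = g v\<close> g[OF that(1)] in auto)
      with not_real show False ..
    qed
    show ?thesis
    proof (cases "\<exists>\<epsilon>. card {v \<in> C. g v = \<epsilon>} \<ge> 2")
      case True
      then obtain \<epsilon> where "card {v \<in> C. g v = \<epsilon>} \<ge> 2" by blast
      moreover define S where "S = {v \<in> C. g v = \<epsilon>}"
      ultimately obtain h where h: "\<forall>v\<in>S. \<not> t dvd h v" "(\<Sum>v\<in>S. h v) = 0"
        using nonzero_values_sum_zero[of t S] \<open>finite C\<close> \<open>t > k\<close> \<open>k \<ge> 2\<close> by auto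
      let ?f = "\<lambda>v. if v \<in> S then h v else 0"
      \<comment> \<open>The sign is constant on \<open>S\<close>, so the root coefficient is a
        multiple of the sum of \<open>h\<close>, which is 0.\<close>
      have "(\<Sum>v\<in>C. ?f v * g v) = (\<Sum>v\<in>S. h v * \<epsilon>)"
        using \<open>finite C\<close> by (intro sum.mono_neutral_cong_right) (auto simp: S_def)
      also have "\<dots> = 0" using h(2) by (simp add: sum_distrib_right[symmetric])
      finally have "realizable t V E (\<lambda>x. (\<Sum>v\<in>C. ?f v * g v) * unit_at r x)"
        using realizable_zero by simp
      then have "realizable t V E ?f"
        by (rule realizable_expand[OF \<open>finite C\<close> _ gR, rotated 2]) (auto simp: S_def)
      moreover have "\<not> [?f u = ?f v] (mod t)" if "u \<in> C" "v \<in> C" "{u, v} \<in> E" for u v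
      proof -
        have "\<not> (u \<in> S \<and> v \<in> S)" "u \<in> S \<or> v \<in> S"
        proof -
          show "\<not> (u \<in> S \<and> v \<in> S)" using bip[OF that] by (auto simp: S_def)
          \<comment> \<open>A member of the class shows that \<epsilon> is 1 or -1, so one of two
            ends with opposite signs must lie in \<open>S\<close>.\<close>
          obtain y where "y \<in> C" "g y = \<epsilon>"
            using \<open>card {v \<in> C. g v = \<epsilon>} \<ge> 2\<close> by (metis (mono_tags, lifting) card.empty empty_Collect_eq not_numeral_le_zero)
          with g[OF that(1)] g[OF that(2)] g[of y] bip[OF that] that(1,2) show "u \<in> S \<or> v \<in> S"
            by (auto simp: S_def)
        qed
        then show ?thesis using h(1) by (auto simp: cong_0_iff cong_sym_eq[of 0])
      qed
      ultimately show ?thesis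
        by (intro exI[of _ ?f]) (auto simp: S_def)
    next
      case False
      have single: "u = v" if "u \<in> C" "v \<in> C" "g u = g v" for u v
      proof -
        have "card {x \<in> C. g x = g v} \<le> 1"
          using False by (metis not_less_eq_eq numeral_2_eq_2 One_nat_def)
        then show ?thesis
          using that \<open>finite C\<close> by (intro card_le_Suc0_iff_eq[THEN iffD1, rule_format, of "{x \<in> C. g x = g v}"]) auto
      qed
      \<comment> \<open>Each sign now occurs at most once, so an edge would fill the whole component
        and make it a \<open>K2\<close>. Without edges the zero function will do.\<close>
      have "{u, v} \<notin> E" if uv: "u \<in> C" "v \<in> C" for u v
      proof
        assume e: "{u, v} \<in> E"
        have "C = {u, v}"
        proof
          show "C \<subseteq> {u, v}"
          proof
            fix x assume "x \<in> C"
            have "g x = g u \<or> g x = g v"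
              using g[OF \<open>x \<in> C\<close>] g[OF uv(1)] g[OF uv(2)] bip[OF uv e] by auto
            then show "x \<in> {u, v}"
              using single[OF \<open>x \<in> C\<close>] uv by blast
          qed
        qed (use uv in simp)
        with graph_isomorphic_K2[OF G e] nice C show False
          unfolding nice_graph_def by blast
      qed
      then show ?thesis
        by (intro exI[of _ "\<lambda>v. 0"]) (auto intro: realizable_zero)
    qed
  qed
qed

theorem theorem3:
  fixes V :: "'a set" and E :: "'a set set" and k :: int
  assumes "finite_simple_graph V E"
    and "nice_graph V E"
    and "k \<ge> 2"
    and "admits_improper_twin_edge_coloring k V E"
  shows "\<forall>t\<ge>k. admits_improper_twin_edge_coloring t V E"
proof (intro allI impI)
  fix t assume "t \<ge> k"
  show "admits_improper_twin_edge_coloring t V E"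
  proof (cases "t = k")
    case False
    with \<open>t \<ge> k\<close> have "t > k" by simp
    obtain s where s: "improper_twin_edge_coloring k V E s"
      using assms(4) unfolding admits_improper_twin_edge_coloring_def by blast
    let ?CC = "connected_components V E"
    note equiv = equiv_reachable[OF assms(1)]
    have "finite V" using assms(1) unfolding finite_simple_graph_def by simp
    then have finCC: "finite ?CC"
      unfolding connected_components_def by (intro finite_quotient) auto
    have "\<forall>C\<in>?CC. \<exists>f. (\<forall>u\<in>C. \<forall>v\<in>C. {u, v} \<in> E \<longrightarrow> \<not> [f u = f v] (mod t)) \<and>
             (\<forall>v. v \<notin> C \<longrightarrow> f v = 0) \<and> realizable t V E f"
    proof
      fix C assume "C \<in> ?CC"
      with s show "\<exists>f. (\<forall>u\<in>C. \<forall>v\<in>C. {u, v} \<in> E \<longrightarrow> \<not> [f u = f v] (mod t)) \<and>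
             (\<forall>v. v \<notin> C \<longrightarrow> f v = 0) \<and> realizable t V E f"
        unfolding improper_twin_edge_coloring_def
        by (intro component_proper_realizable[OF assms(1-3) \<open>t > k\<close> _ improper_twin_edge_coloring_range[OF s assms(3)]]) auto
    qed
    then obtain F where proper: "\<And>C u v. C \<in> ?CC \<Longrightarrow> u \<in> C \<Longrightarrow> v \<in> C \<Longrightarrow> {u, v} \<in> E \<Longrightarrow> \<not> [F C u = F C v] (mod t)"
      and supp: "\<And>C v. C \<in> ?CC \<Longrightarrow> v \<notin> C \<Longrightarrow> F C v = 0"
      and real: "\<And>C. C \<in> ?CC \<Longrightarrow> realizable t V E (F C)"
      by metis
    define f where "f = (\<lambda>v. \<Sum>C\<in>?CC. F C v)"
    have f: "f v = F C v" if "C \<in> ?CC" "v \<in> C" for C v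
    proof -
      \<comment> \<open>Components are disjoint and \<open>F D\<close> vanishes off
        \<open>D\<close>, so at a vertex of \<open>C\<close> only the summand of \<open>C\<close>
        survives.\<close>
      have "F D v = 0" if "D \<in> ?CC - {C}" for D
        using quotient_disj[OF equiv, of C D] that \<open>C \<in> ?CC\<close> \<open>v \<in> C\<close> supp[of D v]
        unfolding connected_components_def by blast
      then show ?thesis
        using finCC that by (simp add: f_def sum.remove)
    qed
    show ?thesis
    proof (rule admits_improper_twin_edge_coloringI[OF assms(1)])
      show "t \<ge> 2" using assms(3) \<open>t \<ge> k\<close> by simp
      show "realizable t V E f"
        unfolding f_def using finCC real by (rule realizable_sum)
      show "\<not> [f u = f v] (mod t)" if e: "{u, v} \<in> E" for u v
      proof -
        note uv = edgeD[OF assms(1) e]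
        \<comment> \<open>Both ends of an edge lie in the class of \<open>u\<close>, so properness
          can be checked within one component.\<close>
        define C where "C = {(u, v) \<in> V \<times> V. (\<lambda>x y. {x, y} \<in> E)\<^sup>*\<^sup>* u v} `` {u}"
        have "C \<in> ?CC"
          unfolding C_def connected_components_def using uv by (intro quotientI)
        moreover have "u \<in> C" "v \<in> C"
          using uv e by (auto simp: C_def)
        ultimately show ?thesis using proper e by (simp add: f)
      qed
    qed
  qed (use assms(4) in simp)
qed

end
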